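(* Let $p$ be a prime with $p>9$, let $n\ge 1$, let $q=p^n$, and let $\mathbb{F}_q$ be the finite field with $q$ elements. For every integer $\ell$ with $q-\sqrt{p}-1\leq \ell < q-3$ there exists a multiset $M$ of $q$ elements of $\mathbb{F}_q$ with $\sum_{b\in M} b=0$ (sum taken with multiplicity), in which the highest multiplicity of an element is $\ell$ and this is achieved at $0\in M$, such that every polynomial over $\mathbb{F}_q$ with range $M$ has degree greater than $\ell$.
   Context: A multiset $M$ of size $q$ of elements of $\mathbb{F}_q$ is called the range of a polynomial $f(x)\in\mathbb{F}_q[x]$ if $M=\{f(x): x\in\mathbb{F}_q\}$ as multisets, i.e. for each $a\in\mathbb{F}_q$ the multiplicity of $a$ in $M$ equals the number of $x\in\mathbb{F}_q$ with $f(x)=a$. *)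

theory Defs
  imports Complex_Main "HOL-Library.Multiset" "HOL-Computational_Algebra.Polynomial"
    "HOL-Computational_Algebra.Primes"
begin

text \<open>Over a finite field, \<open>M\<close> is the range of \<open>f\<close> if the multiplicity of every \<open>a\<close> in \<open>M\<close> is the
  number of field elements that \<open>f\<close> maps to \<open>a\<close>; this forces \<open>size M = CARD('a)\<close>.\<close>

definition is_range_of :: "'a::{field,finite} multiset \<Rightarrow> 'a poly \<Rightarrow> bool" where
  "is_range_of M f \<longleftrightarrow> (\<forall>a. count M a = card {x. poly f x = a})"

definition highest_multiplicity :: "'a multiset \<Rightarrow> nat" where
  "highest_multiplicity M = Max (count M ` set_mset M)"

end

theory Submission
  imports Defs "HOL-Computational_Algebra.Polynomial_FPS"
begin

text \<open>
  Put \<open>k = q - \<ell> - 2\<close>, so that \<open>2 \<le> k < p\<close>. The multiset \<open>M\<close> consists of \<open>\<ell>\<close> zeros, \<open>k\<close> ones and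
  the two further values \<open>-1\<close> and \<open>-(k - 1)\<close>.

  Let \<open>f\<close> have range \<open>M\<close>, and let \<open>R\<close> be the set of the \<open>k\<close> points where \<open>f\<close> is \<open>1\<close>, and \<open>a\<close>, \<open>b\<close> the
  points where \<open>f\<close> takes the values \<open>-1\<close> and \<open>-(k - 1)\<close>. A polynomial of degree less than \<open>q - 1\<close>
  has value sum zero over the field. If \<open>f\<close> had degree at most \<open>\<ell>\<close>, this would hold for \<open>f(x) x\<^sup>j\<close>
  for all \<open>j \<le> k\<close>, because \<open>\<ell> + k = q - 2\<close>. Written out, these equations say
  \<open>\<Sum>\<^sub>r r\<^sup>j = a\<^sup>j + (k - 1) b\<^sup>j\<close> where \<open>r\<close> runs through \<open>R\<close>: the negatives of the two exceptional
  values act as multiplicities, and the two multisets \<open>R\<close> and \<open>{a, b, \<dots>, b}\<close>, both of size \<open>k\<close>,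
  have the same power sums up to exponent \<open>k\<close>. By Newton's identities such multisets are equal when the
  characteristic exceeds \<open>k\<close> (\<open>multiset_eq_if_power_sums_eq\<close>). Hence \<open>a \<in> R\<close>, so
  \<open>-1 = f(a) = 1\<close>, which is absurd in odd characteristic.

  The bound \<open>\<ell> < q - 3\<close> gives \<open>k \<ge> 2\<close>, which makes \<open>-(k - 1)\<close> nonzero. The lower bound on \<open>\<ell>\<close>
  keeps \<open>k\<close> below \<open>p\<close> and makes \<open>0\<close> the most frequent element of \<open>M\<close>.
\<close>

unbundle fps_syntax

section \<open>Power sums and multisets\<close>

text \<open>
  The logarithmic derivative of \<open>1 - a X\<close> is \<open>-a / (1 - a X)\<close>, a geometric series whose coefficients
  are the powers of \<open>a\<close>. Comparing coefficients in this identity yields Newton's identities, since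
  the coefficients of the product are, up to sign, the elementary symmetric functions of \<open>A\<close>.
\<close>

lemma fps_deriv_prod_linear_factors:
  fixes A :: "'a::field multiset"
  shows "fps_deriv (\<Prod>a\<in>#A. 1 - fps_const a * fps_X) =
    - (\<Prod>a\<in>#A. 1 - fps_const a * fps_X) * Abs_fps (\<lambda>n. \<Sum>a\<in>#A. a ^ Suc n)"
proof (induction A)
  case empty
  show ?case by (simp add: fps_eq_iff)
next
  case (add a A)
  let ?F = "\<Prod>a\<in>#A. 1 - fps_const a * fps_X"
  let ?S = "Abs_fps (\<lambda>n. \<Sum>a\<in>#A. a ^ Suc n)"
  define u where "u = 1 - fps_const a * fps_X"
  define G where "G = Abs_fps (\<lambda>n. a ^ Suc n)"
  have geom: "u * G = fps_const a"
  proof (rule fps_ext)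
    fix n
    have "u * G = G - fps_const a * (fps_X * G)"
      by (simp add: u_def left_diff_distrib mult.assoc)
    then show "(u * G) $ n = fps_const a $ n"
      by (cases n) (simp_all add: G_def)
  qed
  have S: "Abs_fps (\<lambda>n. \<Sum>a\<in>#add_mset a A. a ^ Suc n) = G + ?S"
    by (simp add: fps_eq_iff G_def)
  have "fps_deriv (u * ?F) = - fps_const a * ?F + u * fps_deriv ?F"
    by (simp add: u_def)
  also have "\<dots> = - (u * ?F) * (G + ?S)"
    unfolding add.IH geom[symmetric] by (simp add: algebra_simps)
  finally show ?case
    unfolding S by (simp add: u_def)
qed

text \<open>
  This transfers knowledge of the power series back to the polynomial with root multiset \<open>A\<close>, from
  which \<open>A\<close> can be read off.
\<close>

lemma fps_of_poly_reflect_prod_linear_factors: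
  fixes A :: "'a::field multiset"
  shows "fps_of_poly (reflect_poly (\<Prod>a\<in>#A. [:-a, 1:])) = (\<Prod>a\<in>#A. 1 - fps_const a * fps_X)"
proof (induction A)
  case (add a A)
  have "reflect_poly [:-a, 1:] = [:1, -a:]"
    by (simp add: reflect_poly_def cCons_def)
  then show ?case
    using add.IH
    by (simp add: reflect_poly_mult fps_of_poly_mult fps_of_poly_linear' del: mult_pCons_left
        flip: fps_const_neg)
qed simp

lemma prod_mset_linear_factors_neq_0:
  fixes A :: "'a::field multiset"
  shows "(\<Prod>a\<in>#A. [:-a, 1:]) \<noteq> 0"
  by (induction A) (simp_all del: mult_pCons_left)

lemma degree_prod_mset_linear_factors:
  fixes A :: "'a::field multiset"
  shows "degree (\<Prod>a\<in>#A. [:-a, 1:]) = size A"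
  by (induction A) (simp_all add: degree_mult_eq prod_mset_linear_factors_neq_0
      del: mult_pCons_left prod_mset_zero_iff)

text \<open>
  Newton's identities express \<open>n\<close> times the \<open>n\<close>-th coefficient of the product of all \<open>1 - a X\<close> through
  earlier coefficients and power sums. As \<open>n \<le> k\<close> can be cancelled, the power sums determine the
  product, hence its roots.
\<close>

lemma multiset_eq_if_power_sums_eq:
  fixes A B :: "'a::field multiset"
  assumes size: "size A = k" "size B = k"
    and char: "\<And>i. 0 < i \<Longrightarrow> i \<le> k \<Longrightarrow> of_nat i \<noteq> (0::'a)"
    and power_sums: "\<And>j. 0 < j \<Longrightarrow> j \<le> k \<Longrightarrow> (\<Sum>a\<in>#A. a ^ j) = (\<Sum>b\<in>#B. b ^ j)"
  shows "A = B"
proof -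
  let ?F = "\<lambda>A::'a multiset. \<Prod>a\<in>#A. 1 - fps_const a * fps_X"
  let ?P = "\<lambda>A::'a multiset. \<Prod>a\<in>#A. [:-a, 1:]"
  have newton: "of_nat (Suc n) * ?F A $ Suc n = - (\<Sum>i=0..n. ?F A $ i * (\<Sum>a\<in>#A. a ^ Suc (n - i)))"
    for A :: "'a multiset" and n
    using arg_cong[OF fps_deriv_prod_linear_factors[of A], of "\<lambda>f. f $ n"]
    by (simp add: fps_mult_nth sum_negf)
  have F0: "?F A $ 0 = 1" for A :: "'a multiset"
    by (induction A) simp_all
  have F: "?F A $ n = ?F B $ n" if "n \<le> k" for n
    using that
  proof (induction n rule: less_induct)
    case (less n)
    show ?case
    proof (cases n)
      case 0
      then show ?thesis by (simp only: F0)
    next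
      case (Suc m)
      have "of_nat (Suc m) * ?F A $ Suc m = of_nat (Suc m) * ?F B $ Suc m"
        unfolding newton using less Suc by (auto intro!: sum.cong simp: power_sums simp del: power_Suc)
      then show ?thesis
        using char[of n] less.prems Suc by simp
    qed
  qed
  have coeff: "coeff (?P A) j = ?F A $ (k - j)" if "size A = k" "j \<le> k" for A :: "'a multiset" and j
    using that unfolding fps_of_poly_reflect_prod_linear_factors[symmetric]
    by (simp add: coeff_reflect_poly degree_prod_mset_linear_factors)
  have "?P A = ?P B"
  proof (rule poly_eqI)
    fix j
    show "coeff (?P A) j = coeff (?P B) j"
    proof (cases "j \<le> k")
      case True
      then show ?thesis using size by (simp add: coeff F)
    next
      case False
      then show ?thesis using size by (simp add: coeff_eq_0 degree_prod_mset_linear_factors)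
    qed
  qed
  moreover have "proots (?P A) = A" for A :: "'a multiset"
    by (induction A) (simp_all add: proots_mult prod_mset_linear_factors_neq_0
      del: mult_pCons_left prod_mset_zero_iff)
  ultimately show ?thesis by metis
qed

section \<open>Sums over a finite field\<close>

text \<open>The translation \<open>x \<mapsto> x + 1\<close> permutes the field, so it does not change the sum of all elements.\<close>

lemma of_nat_card_UNIV_eq_0:
  "of_nat (card (UNIV :: 'a set)) = (0::'a::{field,finite})"
proof -
  have "(\<Sum>x\<in>(UNIV::'a set). x) = (\<Sum>x\<in>UNIV. x + 1)"
    by (intro sum.reindex_bij_witness[of _ "\<lambda>x. x + 1" "\<lambda>x. x - 1"]) auto
  then show ?thesis
    by (simp add: sum.distrib)
qed

text \<open>
  For \<open>0 < j < q - 1\<close> the polynomial \<open>x\<^sup>j - 1\<close> has too few roots to vanish at every nonzero element. An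
  element \<open>u\<close> where it does not vanish scales the sum by \<open>u\<^sup>j \<noteq> 1\<close> while merely permuting the
  summands.
\<close>

lemma sum_power_finite_field_eq_0:
  assumes "j < card (UNIV :: 'a::{field,finite} set) - 1"
  shows "(\<Sum>x\<in>(UNIV::'a set). x ^ j) = 0"
proof (cases "j = 0")
  case True
  then show ?thesis
    by (simp add: of_nat_card_UNIV_eq_0)
next
  case False
  define P where "P = monom (1::'a) j - 1"
  have "coeff P j = 1"
    using False by (simp add: P_def)
  then have "P \<noteq> 0" by auto
  have "degree P \<le> j"
    unfolding P_def by (intro degree_diff_le) (simp_all add: degree_monom_le)
  have "card {x. poly P x = 0} < card (UNIV - {0::'a})"
    using card_poly_roots_bound[OF \<open>P \<noteq> 0\<close>] \<open>degree P \<le> j\<close> assms by (simp add: card_Diff_singleton)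
  then have "\<not> UNIV - {0} \<subseteq> {x. poly P x = 0}"
    by (meson card_mono finite leD)
  then obtain u :: 'a where "u \<noteq> 0" "u ^ j \<noteq> 1"
    by (auto simp: P_def poly_monom)
  have "(\<Sum>x\<in>UNIV. x ^ j) = (\<Sum>x\<in>UNIV. (u * x) ^ j)"
    using \<open>u \<noteq> 0\<close>
    by (intro sum.reindex_bij_witness[of _ "\<lambda>x. u * x" "\<lambda>x. x / u"]) auto
  also have "\<dots> = u ^ j * (\<Sum>x\<in>UNIV. x ^ j)"
    by (simp add: power_mult_distrib sum_distrib_left)
  finally show ?thesis
    using \<open>u ^ j \<noteq> 1\<close> by simp
qed

lemma sum_poly_finite_field_eq_0:
  fixes f :: "'a::{field,finite} poly"
  assumes "degree f < card (UNIV :: 'a set) - 1"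
  shows "(\<Sum>x\<in>UNIV. poly f x) = 0"
proof -
  have "(\<Sum>x\<in>UNIV. poly f x) = (\<Sum>i\<le>degree f. coeff f i * (\<Sum>x\<in>UNIV. x ^ i))"
    unfolding poly_altdef by (subst sum.swap) (simp add: sum_distrib_left)
  also have "\<dots> = 0"
    using assms by (intro sum.neutral ballI) (simp add: sum_power_finite_field_eq_0)
  finally show ?thesis .
qed

section \<open>A multiset that is not the range of a polynomial of low degree\<close>

lemma is_range_of_iff_image_mset:
  "is_range_of M f \<longleftrightarrow> M = image_mset (poly f) (mset_set UNIV)"
  by (simp add: is_range_of_def multiset_eq_iff count_image_mset' eq_commute)

text \<open>
  If the degree were at most \<open>l\<close>, the vanishing of \<open>\<Sum>\<^sub>x f(x) x\<^sup>j\<close> for \<open>j \<le> k\<close> would force the fibre of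
  \<open>f\<close> over \<open>1\<close> to contain the point that is mapped to \<open>-1\<close>.
\<close>

lemma degree_gt_if_range:
  fixes f :: "'a::{field,finite} poly"
  assumes range: "is_range_of
      (replicate_mset l 0 + replicate_mset k 1 + {#- 1, - of_nat (k - 1)#}) f"
    and k: "2 \<le> k" and card: "card (UNIV :: 'a set) = l + k + 2"
    and char: "\<And>i. 0 < i \<Longrightarrow> i \<le> k \<Longrightarrow> of_nat i \<noteq> (0::'a)"
  shows "degree f > l"
proof (rule ccontr)
  assume "\<not> degree f > l"
  then have deg: "degree f \<le> l" by simp
  have "image_mset (poly f) (mset_set UNIV) =
      add_mset (- 1) (add_mset (- of_nat (k - 1)) (replicate_mset l 0 + replicate_mset k 1))"
    using range by (simp add: is_range_of_iff_image_mset)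
  from msed_map_invR[OF this] obtain a A where "mset_set UNIV = add_mset a A" "poly f a = - 1"
    and A: "image_mset (poly f) A =
      add_mset (- of_nat (k - 1)) (replicate_mset l 0 + replicate_mset k 1)"
    by blast
  moreover from msed_map_invR[OF A] obtain b B where "A = add_mset b B"
    "poly f b = - of_nat (k - 1)"
    and B: "image_mset (poly f) B = replicate_mset l 0 + replicate_mset k 1"
    by blast
  moreover from image_mset_eq_plusD[OF B] obtain Z R where "B = Z + R"
    and Z: "image_mset (poly f) Z = replicate_mset l 0"
    and R: "image_mset (poly f) R = replicate_mset k 1"
    by metis
  ultimately have UNIV_eq: "mset_set UNIV = add_mset a (add_mset b (Z + R))"
    and ab: "poly f a = - 1" "poly f b = - of_nat (k - 1)"
    by simp_all
  have poly_Z: "poly f x = 0" if "x \<in># Z" for x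
    using that Z by (metis image_eqI in_replicate_mset set_image_mset)
  have poly_R: "poly f x = 1" if "x \<in># R" for x
    using that R by (metis image_eqI in_replicate_mset set_image_mset)
  have "R = add_mset a (replicate_mset (k - 1) b)"
  proof (rule multiset_eq_if_power_sums_eq[OF _ _ char])
    show "size R = k"
      using R by (metis size_image_mset size_replicate_mset)
    show "size (add_mset a (replicate_mset (k - 1) b)) = k"
      using k by simp
  next
    fix j assume "0 < j" "j \<le> k"
    have "degree (f * monom 1 j) \<le> l + k"
      using degree_mult_le[of f "monom 1 j"] degree_monom_le[of "1::'a" j] deg \<open>j \<le> k\<close> by linarith
    then have "0 = (\<Sum>x\<in>UNIV. poly (f * monom 1 j) x)"
      using card by (intro sum_poly_finite_field_eq_0[symmetric]) simp
    also have "\<dots> = (\<Sum>x\<in>#mset_set UNIV. poly f x * x ^ j)"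
      by (simp add: sum_unfold_sum_mset poly_monom)
    also have "\<dots> = - (a ^ j) - of_nat (k - 1) * b ^ j + (\<Sum>x\<in>#R. x ^ j)"
    proof -
      have "image_mset (\<lambda>x. poly f x * x ^ j) Z = image_mset (\<lambda>_. 0) Z"
        by (intro image_mset_cong) (simp add: poly_Z)
      moreover have "image_mset (\<lambda>x. poly f x * x ^ j) R = image_mset (\<lambda>x. x ^ j) R"
        by (intro image_mset_cong) (simp add: poly_R)
      ultimately show ?thesis
        by (simp add: UNIV_eq ab)
    qed
    finally show "(\<Sum>x\<in>#R. x ^ j) = (\<Sum>x\<in>#add_mset a (replicate_mset (k - 1) b). x ^ j)"
      by (simp add: algebra_simps)
  qed simp_all
  then have "poly f a = 1"
    by (intro poly_R) simp
  with ab have "1 + 1 = (0::'a)"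
    by (metis add.right_inverse)
  then have "of_nat 2 = (0::'a)"
    by simp
  with char[of 2] k show False by simp
qed

lemma CHAR_eq_if_card_eq_prime_power:
  assumes "prime p" "card (UNIV :: 'a::{field,finite} set) = p ^ n"
  shows "CHAR('a) = p"
proof -
  have "prime CHAR('a)"
    by (intro prime_CHAR_semidom finite_imp_CHAR_pos) simp
  moreover have "CHAR('a) dvd p ^ n"
    using of_nat_card_UNIV_eq_0[where 'a='a] assms(2)
    by (simp add: of_nat_eq_0_iff_char_dvd del: of_nat_power)
  ultimately show ?thesis
    using \<open>prime p\<close> by (metis prime_dvd_power primes_dvd_imp_eq)
qed

theorem theorem1:
  fixes p n :: nat and l :: int
  assumes "prime p" and "p > 9" and "n \<ge> 1"
    and "card (UNIV :: 'a::{field,finite} set) = p ^ n"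
    and "real (p ^ n) - sqrt (real p) - 1 \<le> real_of_int l"
    and "l < int (p ^ n) - 3"
  shows "\<exists>M :: 'a multiset.
           size M = p ^ n \<and> \<Sum>\<^sub># M = 0 \<and>
           int (highest_multiplicity M) = l \<and>
           0 \<in># M \<and> int (count M 0) = l \<and>
           (\<forall>f :: 'a poly. is_range_of M f \<longrightarrow> int (degree f) > l)"
proof -
  let ?q = "p ^ n"
  have "p \<le> ?q"
    using assms(1,3) by (metis One_nat_def self_le_power prime_ge_1_nat less_eq_Suc_le)
  \<comment> \<open>Here \<open>p > 9\<close> enters, via \<open>sqrt p \<ge> 3\<close>. The resulting bound \<open>k + 1 \<le> p / 3\<close> leaves enough room for
    both \<open>k < p\<close> and \<open>k + 2 \<le> \<ell>\<close>.\<close>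
  have "sqrt (real p) * 3 \<le> sqrt (real p) * sqrt (real p)"
    using \<open>p > 9\<close> by (intro mult_left_mono real_le_rsqrt) auto
  then have sqrt_p: "3 * sqrt (real p) \<le> real p"
    by simp
  define k where "k = ?q - nat l - 2"
  define L where "L = nat l"
  have l_ge: "real_of_int l \<ge> real ?q - real p / 3 - 1"
    using assms(5) sqrt_p by linarith
  have "real_of_int l > 0"
    using l_ge \<open>p \<le> ?q\<close> \<open>p > 9\<close> by linarith
  then have L: "l = int L" "L > 0"
    by (auto simp: L_def)
  have k: "k \<ge> 2" "?q = L + k + 2"
  proof -
    have "L + 3 < ?q"
      using assms(6) L by linarith
    then show "k \<ge> 2" "?q = L + k + 2"
      by (auto simp: k_def L_def)
  qed
  have "real k \<le> real p / 3 - 1"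
    using l_ge k L by simp
  then have "k < p" and "k + 2 \<le> L"
    using k \<open>p \<le> ?q\<close> \<open>p > 9\<close> by linarith+
  have char: "of_nat i \<noteq> (0::'a)" if "0 < i" "i \<le> k" for i
    using CHAR_eq_if_card_eq_prime_power[OF assms(1,4)] that \<open>k < p\<close>
    by (auto simp: of_nat_eq_0_iff_char_dvd dest: dvd_imp_le)
  define N where "N = replicate_mset k 1 + {#- 1, - of_nat (k - 1) :: 'a#}"
  define M where "M = replicate_mset L 0 + N"
  have N0: "count N 0 = 0"
    using char[of "k - 1"] k by (auto simp: N_def)
  have size_N: "size N = k + 2"
    by (simp add: N_def)
  have count0: "count M 0 = L"
    by (simp add: M_def N0)
  \<comment> \<open>There are only \<open>k + 2 \<le> L\<close> nonzero elements altogether.\<close>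
  have "count M x \<le> L" for x
  proof (cases "x = 0")
    case False
    then have "count M x = count N x" by (simp add: M_def)
    also have "\<dots> \<le> size N" by (rule count_le_size)
    finally show ?thesis using size_N \<open>k + 2 \<le> L\<close> by simp
  qed (simp add: count0)
  moreover have "0 \<in># M"
    using count0 L by (metis count_greater_zero_iff)
  ultimately have highest: "highest_multiplicity M = L"
    unfolding highest_multiplicity_def using count0
    by (intro Max_eqI) (auto intro: image_eqI[of _ _ 0])
  have "\<Sum>\<^sub># M = of_nat k - 1 - of_nat (k - 1)"
    by (simp add: M_def N_def)
  also have "\<dots> = 0"
    using k by (simp add: of_nat_diff)
  finally have "\<Sum>\<^sub># M = 0" .
  moreover have "degree f > L" if "is_range_of M f" for f
    using that k assms(4) char
    by (intro degree_gt_if_range[of L k f]) (simp_all add: M_def N_def add.assoc)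
  moreover have "size M = ?q"
    using k by (simp add: M_def size_N)
  ultimately show ?thesis
    using highest count0 \<open>0 \<in># M\<close> L by (intro exI[of _ M]) auto
qed

end
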